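(* Let $G$ be a weighted digraph with vertex set $V$, $|V|=n$, let $P=S$ (no teleporting) or $P=S_t$ (teleporting), and let $\mathcal{L}=I-P$. Let $\alpha>0$, and let $\wp$ be the pagerank vector of $G$, i.e. the row vector with $\wp(v)=2\tilde I(b_v)-\frac1n$ for $v\in V$, where $\tilde I(b_v)$ is the influence of the vertex $b_v$ in the extended graph $E_\alpha[G]$ built from $P$. Then $\wp$ is the unique probability measure on $V$ (row vector with nonnegative entries summing to $1$) that satisfies $$\wp=\frac{\alpha}{n}\,\mathbf{1}^T(\alpha I+\mathcal{L})^{-1},$$ where $\mathbf{1}\in\mathbb{R}^n$ is the all-ones column vector (and $\alpha I+\mathcal{L}$ is invertible).
   Context: $G$ is a weakly connected (underlying undirected graph connected) weighted directed graph on $V=\{1,\dots,n\}$ with edge set $E\subseteq V\times V$; $ji\in E$ denotes an edge $j\to i$ with weight $w_{ji}>0$. The adjacency matrix $Q$ has $Q_{ij}=w_{ji}$ if $ji\in E$ and $0$ otherwise. The row stochastic matrix $S$ (no teleporting) is obtained by first replacing $Q_{ii}$ by $1$ in every zero row $i$ of $Q$ and then dividing each row by its sum. The row stochastic matrix $S_t$ (teleporting) is obtained by replacing every entry of each zero row of $Q$ by $1/n$ and then dividing each row by its sum. General notions, for a digraph with $N$ vertices and associated row stochastic matrix $A$ (for $i\neq j$: edge $j\to i$ iff $A_{ij}>0$): the reachable set $R(j)$ is $j$ together with all vertices reachable from $j$ by a directed path; a reach is an inclusion-maximal reachable set; let $R_1,\dots,R_k$ be the distinct reaches, $H_i=R_i\setminus\bigcup_{j\ne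 i}R_j$ the exclusive part, $C_i=R_i\setminus H_i$ the common part, and the cabal $B_i$ the set of $r\in R_i$ with $R(r)=R_i$. The right kernel of $I-A$ has a basis of column vectors $\gamma_1,\dots,\gamma_k$ with $\gamma_i=1$ on $H_i$, $\gamma_i\in(0,1)$ on $C_i$, $\gamma_i=0$ off $R_i$, $\sum_i\gamma_i=\mathbf 1$; the left kernel has a basis of row vectors $\bar\gamma_1,\dots,\bar\gamma_k$ that are nonnegative, have support $B_i$, and have entries summing to $1$. Let $\Gamma^0$ be the matrix with columns $\gamma_i$ and $\bar\Gamma^0$ the matrix with rows $\bar\gamma_i$. The influence of a vertex $v$ is $\frac1N\mathbf 1^T\,\Gamma^0\bar\Gamma^0\,\mathbf 1_{\{v\}}$, where $\mathbf 1_{\{v\}}$ is the standard basis column vector at $v$. Extended graph $E_\alpha[G]$ (for $\alpha>0$ and $P\in\{S,S_t\}$): start with the graph on $V$ with weighted adjacency matrix $P$, and for each $v\in V$ add one new vertex $b_v$ and one new edge $b_v\to v$ of weight $\alpha$. It has $2n$ vertices, and with the ordering $b_1,\dots,b_n,1,\dots,n$ its row stochastic matrix is $$\tilde S=\begin{pmatrix} I&0\\ \frac{\alpha}{1+\alpha}I&\frac1{1+\alpha}P\end{pmatrix}.$$ Its reaches are exactly $R(b_1),\dots,R(b_n)$. $\tilde I(b_v)$ denotes the influence of $b_v$ in $E_\alpha[G]$ (with $N=2n$, $A=\tilde S$). *)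

theory Defs
  imports "HOL-Analysis.Analysis"
begin

text \<open>A weighted digraph on the vertex type \<open>'n\<close> is an edge set \<open>E\<close> together with a weight
  function \<open>w\<close> (relevant on \<open>E\<close> only); \<open>(j, i) \<in> E\<close> is the edge from \<open>j\<close> to \<open>i\<close>.
  Loops are allowed.\<close>

definition weighted_digraph :: "('n \<times> 'n) set \<Rightarrow> ('n \<times> 'n \<Rightarrow> real) \<Rightarrow> bool" where
  "weighted_digraph E w \<longleftrightarrow> (\<forall>e\<in>E. w e > 0)"

definition weakly_connected :: "('n \<times> 'n) set \<Rightarrow> bool" where
  "weakly_connected E \<longleftrightarrow> (E \<union> E\<inverse>)\<^sup>* = UNIV"

text \<open>Row \<open>i\<close> collects the weights of the edges \<^emph>\<open>entering\<close> \<open>i\<close>.\<close>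

definition adjacency :: "('n \<times> 'n) set \<Rightarrow> ('n \<times> 'n \<Rightarrow> real) \<Rightarrow> real ^ 'n ^ 'n" where
  "adjacency E w = (\<chi> i j. if (j, i) \<in> E then w (j, i) else 0)"

definition normalize_rows :: "real ^ 'v ^ 'v \<Rightarrow> real ^ 'v ^ 'v" where
  "normalize_rows M = (\<chi> i j. M $ i $ j / (\<Sum>k\<in>UNIV. M $ i $ k))"

definition stoch :: "real ^ 'v ^ 'v \<Rightarrow> real ^ 'v ^ 'v" where
  "stoch Q = normalize_rows (\<chi> i j. if row i Q = 0 \<and> j = i then 1 else Q $ i $ j)"

definition stoch_teleport :: "real ^ 'v ^ 'v \<Rightarrow> real ^ 'v ^ 'v" where
  "stoch_teleport Q =
     normalize_rows (\<chi> i j. if row i Q = 0 then 1 / real CARD('v) else Q $ i $ j)"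


text \<open>The digraph associated with a row stochastic matrix \<open>A\<close>: pairs \<open>(j, i)\<close> are edges
  from \<open>j\<close> to \<open>i\<close>.\<close>

definition edges :: "real ^ 'v ^ 'v \<Rightarrow> ('v \<times> 'v) set" where
  "edges A = {(j, i). i \<noteq> j \<and> A $ i $ j > 0}"

definition reachable_set :: "real ^ 'v ^ 'v \<Rightarrow> 'v \<Rightarrow> 'v set" where
  "reachable_set A j = {i. (j, i) \<in> (edges A)\<^sup>*}"

definition reaches :: "real ^ 'v ^ 'v \<Rightarrow> 'v set set" where
  "reaches A = {R \<in> range (reachable_set A). \<forall>R' \<in> range (reachable_set A). R \<subseteq> R' \<longrightarrow> R' = R}"

definition exclusive_part :: "real ^ 'v ^ 'v \<Rightarrow> 'v set \<Rightarrow> 'v set" where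
  "exclusive_part A R = R - \<Union>(reaches A - {R})"

definition common_part :: "real ^ 'v ^ 'v \<Rightarrow> 'v set \<Rightarrow> 'v set" where
  "common_part A R = R - exclusive_part A R"

definition cabal :: "real ^ 'v ^ 'v \<Rightarrow> 'v set \<Rightarrow> 'v set" where
  "cabal A R = {r \<in> R. reachable_set A r = R}"

text \<open>The kernel bases are indexed by the reaches themselves. Since the number of reaches depends
  on \<open>A\<close>, the matrices of basis vectors are indexed by the finite type \<open>'v set\<close> of all vertex
  sets, the columns (rows) belonging to sets that are not reaches being zero; this does not
  affect the product of the two matrices.\<close>

definition is_right_kernel_basis :: "real ^ 'v ^ 'v \<Rightarrow> real ^ ('v set) ^ 'v \<Rightarrow> bool" where
  "is_right_kernel_basis A \<Gamma> \<longleftrightarrow>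
     (\<forall>R. R \<notin> reaches A \<longrightarrow> column R \<Gamma> = 0) \<and>
     inj_on (\<lambda>R. column R \<Gamma>) (reaches A) \<and>
     independent ((\<lambda>R. column R \<Gamma>) ` reaches A) \<and>
     span ((\<lambda>R. column R \<Gamma>) ` reaches A) = {x. (mat 1 - A) *v x = 0} \<and>
     (\<forall>R \<in> reaches A.
        (\<forall>v \<in> exclusive_part A R. \<Gamma> $ v $ R = 1) \<and>
        (\<forall>v \<in> common_part A R. 0 < \<Gamma> $ v $ R \<and> \<Gamma> $ v $ R < 1) \<and>
        (\<forall>v. v \<notin> R \<longrightarrow> \<Gamma> $ v $ R = 0)) \<and>
     (\<Sum>R \<in> reaches A. column R \<Gamma>) = 1"

definition is_left_kernel_basis :: "real ^ 'v ^ 'v \<Rightarrow> real ^ 'v ^ ('v set) \<Rightarrow> bool" where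
  "is_left_kernel_basis A \<Gamma> \<longleftrightarrow>
     (\<forall>R. R \<notin> reaches A \<longrightarrow> row R \<Gamma> = 0) \<and>
     inj_on (\<lambda>R. row R \<Gamma>) (reaches A) \<and>
     independent ((\<lambda>R. row R \<Gamma>) ` reaches A) \<and>
     span ((\<lambda>R. row R \<Gamma>) ` reaches A) = {y. y v* (mat 1 - A) = 0} \<and>
     (\<forall>R \<in> reaches A.
        (\<forall>v. \<Gamma> $ R $ v \<ge> 0) \<and>
        {v. \<Gamma> $ R $ v \<noteq> 0} = cabal A R \<and>
        (\<Sum>v\<in>UNIV. \<Gamma> $ R $ v) = 1)"

text \<open>For row stochastic \<open>A\<close> both bases exist and are unique: the cabals are the closed
  classes of the Markov chain \<open>A\<close>, an element of the right kernel is determined by its (constant)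
  values on the cabals, and a stationary distribution supported on one cabal is unique.\<close>

definition Gamma0 :: "real ^ 'v ^ 'v \<Rightarrow> real ^ ('v set) ^ 'v" where
  "Gamma0 A = (THE \<Gamma>. is_right_kernel_basis A \<Gamma>)"

definition Gamma0_bar :: "real ^ 'v ^ 'v \<Rightarrow> real ^ 'v ^ ('v set)" where
  "Gamma0_bar A = (THE \<Gamma>. is_left_kernel_basis A \<Gamma>)"

definition influence :: "real ^ 'v ^ 'v \<Rightarrow> 'v \<Rightarrow> real" where
  "influence A v = 1 / real CARD('v) * ((1 v* (Gamma0 A ** Gamma0_bar A)) \<bullet> axis v 1)"


text \<open>The extended graph has vertex type \<open>'n + 'n\<close>: \<open>Inr v\<close> is the old vertex \<open>v\<close> and \<open>Inl v\<close>
  is the new vertex \<open>b\<^sub>v\<close>.\<close>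

definition ext_adjacency :: "real \<Rightarrow> real ^ 'n ^ 'n \<Rightarrow> real ^ ('n + 'n) ^ ('n + 'n)" where
  "ext_adjacency \<alpha> P = (\<chi> x y.
     case (x, y) of
       (Inr i, Inr j) \<Rightarrow> P $ i $ j
     | (Inr i, Inl j) \<Rightarrow> (if i = j then \<alpha> else 0)
     | (Inl i, _) \<Rightarrow> 0)"

definition ext_stoch :: "real \<Rightarrow> real ^ 'n ^ 'n \<Rightarrow> real ^ ('n + 'n) ^ ('n + 'n)" where
  "ext_stoch \<alpha> P = stoch (ext_adjacency \<alpha> P)"

lemma sum_UNIV_sum:
  fixes f :: "'a::finite + 'b::finite \<Rightarrow> real"
  shows "(\<Sum>x\<in>UNIV. f x) = (\<Sum>a\<in>UNIV. f (Inl a)) + (\<Sum>b\<in>UNIV. f (Inr b))"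
  by (simp add: UNIV_Plus_UNIV[symmetric] sum.Plus del: UNIV_Plus_UNIV)

lemma ext_stoch_blocks:
  fixes P :: "real ^ 'n ^ 'n"
  assumes "\<alpha> > 0" and "\<And>i. (\<Sum>j\<in>UNIV. P $ i $ j) = 1"
  shows "ext_stoch \<alpha> P $ Inl i $ Inl j = mat 1 $ i $ j"
    and "ext_stoch \<alpha> P $ Inl i $ Inr j = 0"
    and "ext_stoch \<alpha> P $ Inr i $ Inl j = (\<alpha> / (1 + \<alpha>)) * mat 1 $ i $ j"
    and "ext_stoch \<alpha> P $ Inr i $ Inr j = (1 / (1 + \<alpha>)) * P $ i $ j"
proof -
  have z: "row (Inl i) (ext_adjacency \<alpha> P) = 0" for i
    by (simp add: row_def ext_adjacency_def vec_eq_iff)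
  have nz: "row (Inr i) (ext_adjacency \<alpha> P) \<noteq> 0" for i
  proof
    assume "row (Inr i) (ext_adjacency \<alpha> P) = 0"
    then have "row (Inr i) (ext_adjacency \<alpha> P) $ Inl i = 0" by simp
    with assms(1) show False by (simp add: row_def ext_adjacency_def)
  qed
  have e: "ext_adjacency \<alpha> P $ Inl i $ y = 0"
    "ext_adjacency \<alpha> P $ Inr i $ Inl j = (if i = j then \<alpha> else 0)"
    "ext_adjacency \<alpha> P $ Inr i $ Inr j = P $ i $ j" for i j y
    by (simp_all add: ext_adjacency_def)
  note simps = ext_stoch_def stoch_def normalize_rows_def z nz sum_UNIV_sum mat_def e
  show "ext_stoch \<alpha> P $ Inl i $ Inl j = mat 1 $ i $ j"
    by (simp add: simps eq_commute[of j] cong: if_cong)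
  show "ext_stoch \<alpha> P $ Inl i $ Inr j = 0"
    by (simp add: simps cong: if_cong)
  show "ext_stoch \<alpha> P $ Inr i $ Inl j = (\<alpha> / (1 + \<alpha>)) * mat 1 $ i $ j"
    by (simp add: simps assms(2) add.commute cong: if_cong)
  show "ext_stoch \<alpha> P $ Inr i $ Inr j = (1 / (1 + \<alpha>)) * P $ i $ j"
    by (simp add: simps assms(2) add.commute cong: if_cong)
qed

definition pagerank :: "real \<Rightarrow> real ^ 'n ^ 'n \<Rightarrow> real ^ 'n" where
  "pagerank \<alpha> P = (\<chi> v. 2 * influence (ext_stoch \<alpha> P) (Inl v) - 1 / real CARD('n))"

definition prob_vector :: "real ^ 'n \<Rightarrow> bool" where
  "prob_vector x \<longleftrightarrow> (\<forall>v. x $ v \<ge> 0) \<and> (\<Sum>v\<in>UNIV. x $ v) = 1"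

end

theory Submission imports Defs begin

text \<open>
  The matrix \<open>absorption = \<alpha> (\<alpha> I + I - P)\<inverse>\<close> has a probabilistic meaning: run the Markov
  chain \<open>P\<close> from \<open>i\<close> (it follows the edges of the graph backwards), but before each step stop
  with probability \<open>\<alpha> / (1 + \<alpha>)\<close>; its entry \<open>(i, v)\<close> is the probability of stopping at \<open>v\<close>. In the extended graph, stopping at \<open>v\<close> means
  moving to the absorbing state \<open>b\<^sub>v\<close>, and these are the only closed classes. The two kernel
  bases of \<open>I - A\<close>, with \<open>A\<close> the matrix of the extended graph, can therefore be written down.

  \<^item> On the right, a vector is in the kernel iff its values on the old vertices are \<open>absorption\<close>
    applied to its boundary values on the \<open>b\<^sub>u\<close>. The defining conditions on \<open>\<gamma>\<^sub>v\<close> force the boundary values \<open>1\<close> at \<open>b\<^sub>v\<close>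
    and \<open>0\<close> at the other \<open>b\<^sub>u\<close>, so \<open>\<gamma>\<^sub>v\<close> is column \<open>v\<close> of \<open>absorption\<close> on the old vertices.
  \<^item> On the left, the cabal of the reach of \<open>b\<^sub>v\<close> is \<open>{b\<^sub>v}\<close>, so the row vector is the unit
    vector at \<open>b\<^sub>v\<close>.

  Hence \<open>2n\<close> times the influence of \<open>b\<^sub>v\<close> is the sum of the entries of \<open>\<gamma>\<^sub>v\<close>, that is \<open>1\<close> plus the
  sum of column \<open>v\<close> of \<open>absorption\<close>; after the affine normalisation the pagerank of \<open>v\<close> is the
  average of that column. This is the claimed formula, and since \<open>absorption\<close> is itself row
  stochastic, the pagerank is a probability vector.

  The matrices \<open>Gamma0\<close> and \<open>Gamma0_bar\<close> are given by definite descriptions, so both existence and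
  uniqueness of the bases have to be shown. Existence on the right needs the zero pattern of
  \<open>absorption\<close>: its entry \<open>(i, v)\<close> is positive exactly when \<open>i\<close> is reachable from \<open>v\<close>.
  Positivity propagates along paths (\<open>absorption_first_step\<close>). The vanishing of the other entries,
  the nonnegativity of \<open>absorption\<close> and the invertibility of \<open>\<alpha> I + I - P\<close> all come from one
  discrete maximum principle (\<open>maximum_principle\<close>).
\<close>

section \<open>Row stochastic matrices\<close>

definition row_stochastic :: "real ^ 'n ^ 'n \<Rightarrow> bool" where
  "row_stochastic P \<longleftrightarrow> (\<forall>i j. P $ i $ j \<ge> 0) \<and> (\<forall>i. (\<Sum>j\<in>UNIV. P $ i $ j) = 1)"

lemma row_stochastic_normalize_rows:
  assumes "\<And>i j. M $ i $ j \<ge> 0" and "\<And>i. row i M \<noteq> 0"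
  shows "row_stochastic (normalize_rows M)"
proof -
  have "(\<Sum>k\<in>UNIV. M $ i $ k) > 0" for i
  proof -
    obtain k where "M $ i $ k \<noteq> 0"
      using assms(2)[of i] by (auto simp: row_def vec_eq_iff)
    then have "M $ i $ k > 0"
      using assms(1)[of i k] by linarith
    then show ?thesis
      using assms(1) by (intro sum_pos2[of _ k]) auto
  qed
  then show ?thesis
    using assms(1) unfolding row_stochastic_def normalize_rows_def
    by (auto simp flip: sum_divide_distrib intro!: divide_nonneg_nonneg sum_nonneg)
       (metis less_irrefl)
qed

lemma row_stochastic_stoch:
  assumes "\<And>i j. Q $ i $ j \<ge> 0"
  shows "row_stochastic (stoch Q)"
  unfolding stoch_def
proof (rule row_stochastic_normalize_rows)
  show "row i (\<chi> i j. if row i Q = 0 \<and> j = i then 1 else Q $ i $ j) \<noteq> 0" for i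
  proof (cases "row i Q = 0")
    case True
    then have "row i (\<chi> i j. if row i Q = 0 \<and> j = i then 1 else Q $ i $ j) $ i = 1"
      by (simp add: row_def)
    then show ?thesis
      by (metis zero_index zero_neq_one)
  next
    case False
    then have "row i (\<chi> i j. if row i Q = 0 \<and> j = i then 1 else Q $ i $ j) = row i Q"
      by (simp add: row_def vec_eq_iff)
    with False show ?thesis by metis
  qed
qed (use assms in auto)

lemma row_stochastic_stoch_teleport:
  assumes "\<And>i j. Q $ i $ j \<ge> 0"
  shows "row_stochastic (stoch_teleport Q)"
  unfolding stoch_teleport_def
proof (rule row_stochastic_normalize_rows)
  let ?M = "\<chi> i j. if row i Q = 0 then 1 / real CARD('a) else Q $ i $ j"
  show "row i ?M \<noteq> 0" for i
  proof (cases "row i Q = 0")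
    case True
    then have "row i ?M $ i \<noteq> 0"
      by (simp add: row_def)
    then show ?thesis
      by (metis zero_index)
  next
    case False
    then have "row i ?M = row i Q"
      by (simp add: row_def vec_eq_iff)
    with False show ?thesis by metis
  qed
qed (use assms in auto)

lemma adjacency_nonneg:
  assumes "weighted_digraph E w"
  shows "adjacency E w $ i $ j \<ge> 0"
  using assms by (auto simp: adjacency_def weighted_digraph_def less_imp_le)

lemma sum_UNIV_if_eq:
  fixes f :: "'a::finite \<Rightarrow> real"
  shows "(\<Sum>j\<in>UNIV. f j * (if j = i then 1 else 0)) = f i"
    and "(\<Sum>j\<in>UNIV. (if i = j then 1 else 0) * f j) = f i"
  by (simp_all add: if_distrib[of "\<lambda>x. _ * x"] if_distrib[of "\<lambda>x. x * _"] cong: if_cong)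

section \<open>The killed walk and its absorption probabilities\<close>

text \<open>Teleporting or not, \<open>P\<close> is row stochastic, so both cases are treated at once.\<close>

locale extended_graph =
  fixes P :: "real ^ 'n::finite ^ 'n" and \<alpha> :: real
  assumes stochastic: "row_stochastic P" and alpha_pos: "\<alpha> > 0"
begin

lemma P_nonneg: "P $ i $ j \<ge> 0"
  and P_row_sum: "(\<Sum>j\<in>UNIV. P $ i $ j) = 1"
  using stochastic by (auto simp: row_stochastic_def)

text \<open>At a maximum of \<open>x\<close> over \<open>Z\<close>, with value \<open>m\<close>, the average \<open>P x\<close> only sees values of \<open>x\<close> on \<open>Z\<close>
  and so is at most \<open>m\<close>; the hypothesis then gives \<open>(1 + \<alpha>) m \<le> m\<close>. The closed set \<open>Z\<close> is all of
  the vertices when sign and uniqueness are at stake, and the set of vertices not reachable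
  from \<open>v\<close> when the zero pattern is.\<close>

lemma maximum_principle:
  fixes x :: "real ^ 'n"
  assumes closed: "\<And>i j. i \<in> Z \<Longrightarrow> P $ i $ j \<noteq> 0 \<Longrightarrow> j \<in> Z"
    and sub: "\<And>i. i \<in> Z \<Longrightarrow> (1 + \<alpha>) * x $ i \<le> (P *v x) $ i"
    and "i \<in> Z"
  shows "x $ i \<le> 0"
proof -
  define m where "m = Max (($) x ` Z)"
  have le: "x $ j \<le> m" if "j \<in> Z" for j
    unfolding m_def using that by (intro Max_ge) auto
  have "m \<in> ($) x ` Z"
    unfolding m_def using \<open>i \<in> Z\<close> by (intro Max_in) auto
  then obtain k where k: "k \<in> Z" "x $ k = m" by auto
  have "(1 + \<alpha>) * m \<le> (\<Sum>j\<in>UNIV. P $ k $ j * x $ j)"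
    using sub[OF k(1)] k(2) by (simp add: matrix_vector_mult_def)
  also have "\<dots> \<le> (\<Sum>j\<in>UNIV. P $ k $ j * m)"
  proof (rule sum_mono)
    show "P $ k $ j * x $ j \<le> P $ k $ j * m" for j
      using closed[OF k(1), of j] le[of j] P_nonneg[of k j]
      by (cases "P $ k $ j = 0") (auto intro: mult_left_mono)
  qed
  also have "\<dots> = m"
    by (simp add: P_row_sum flip: sum_distrib_right)
  finally have "\<alpha> * m \<le> 0" by (simp add: algebra_simps)
  then have "m \<le> 0"
    using alpha_pos by (simp add: mult_le_0_iff)
  with le[OF \<open>i \<in> Z\<close>] show ?thesis by simp
qed

abbreviation D :: "real ^ 'n ^ 'n" where
  "D \<equiv> \<alpha> *\<^sub>R mat 1 + (mat 1 - P)"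

lemma D_mult: "D *v x = (1 + \<alpha>) *\<^sub>R x - P *v x"
  by (simp add: matrix_vector_mult_add_rdistrib matrix_vector_mult_diff_rdistrib
      scaleR_matrix_vector_assoc[symmetric] algebra_simps)

lemma D_kernel:
  assumes "D *v x = 0"
  shows "x = 0"
proof -
  have eq: "(1 + \<alpha>) * x $ i = (P *v x) $ i" for i
    using assms by (simp add: D_mult vec_eq_iff)
  have neg: "(P *v (- x)) $ i = - (P *v x) $ i" for i
    by (simp add: matrix_vector_mult_def sum_negf)
  have "x $ i \<le> 0" "(- x) $ i \<le> 0" for i
    by (rule maximum_principle[of UNIV]; simp add: eq neg)+
  then show ?thesis
    by (simp add: vec_eq_iff order_antisym)
qed

lemma D_invertible: "invertible D"
  using D_kernel invertible_left_inverse matrix_left_invertible_ker by blast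

text \<open>The scaling by \<open>\<alpha>\<close> makes the rows sum to \<open>1\<close>, since \<open>D\<close> maps the all-ones vector to \<open>\<alpha>\<close>
  times itself.\<close>

definition absorption :: "real ^ 'n ^ 'n" where
  "absorption = \<alpha> *\<^sub>R matrix_inv D"

lemma D_absorption_mult: "D *v (absorption *v x) = \<alpha> *\<^sub>R x"
proof -
  have "D ** matrix_inv D = mat 1"
    using D_invertible unfolding invertible_def matrix_inv_def by (metis (mono_tags, lifting) someI_ex)
  then show ?thesis
    by (simp add: absorption_def scaleR_matrix_vector_assoc[symmetric] matrix_vector_mult_scaleR
        matrix_vector_mul_assoc)
qed

text \<open>Multiplying \<open>y = absorption *v x\<close> by \<open>D\<close> removes the inverse: the equation on the right says
  that \<open>y\<close> averages the boundary value \<open>x\<close>, with weight \<open>\<alpha> / (1 + \<alpha>)\<close>, and the values of \<open>y\<close> one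
  step further, with weight \<open>1 / (1 + \<alpha>)\<close>.\<close>

lemma absorption_mult_eq_iff: "y = absorption *v x \<longleftrightarrow> (1 + \<alpha>) *\<^sub>R y = \<alpha> *\<^sub>R x + P *v y"
proof -
  have "y = absorption *v x \<longleftrightarrow> D *v y = D *v (absorption *v x)"
    using D_kernel[of "y - absorption *v x"] by (auto simp: matrix_vector_mult_diff_distrib)
  also have "\<dots> \<longleftrightarrow> (1 + \<alpha>) *\<^sub>R y = \<alpha> *\<^sub>R x + P *v y"
    unfolding D_absorption_mult unfolding D_mult by (simp add: diff_eq_eq)
  finally show ?thesis .
qed

lemma absorption_mult_one: "absorption *v 1 = 1"
proof -
  have "P *v 1 = 1"
    by (simp add: vec_eq_iff matrix_vector_mult_def P_row_sum)
  then have "1 = absorption *v 1"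
    by (subst absorption_mult_eq_iff) (simp add: algebra_simps)
  then show ?thesis by simp
qed

lemma absorption_row_sum: "(\<Sum>v\<in>UNIV. absorption $ i $ v) = 1"
  using arg_cong[OF absorption_mult_one, of "\<lambda>y. y $ i"] by (simp add: matrix_vector_mult_def)

text \<open>Conditioning on the first step of the walk. The sign pattern of \<open>absorption\<close> is read off from
  this recursion.\<close>

lemma absorption_first_step:
  "(1 + \<alpha>) * absorption $ i $ v =
    (if i = v then \<alpha> else 0) + (\<Sum>j\<in>UNIV. P $ i $ j * absorption $ j $ v)"
proof -
  have "(1 + \<alpha>) *\<^sub>R column v absorption = \<alpha> *\<^sub>R axis v 1 + P *v column v absorption"
    using absorption_mult_eq_iff[of "column v absorption" "axis v 1"]
    by (simp add: matrix_vector_mult_basis)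
  from arg_cong[OF this, of "\<lambda>y. y $ i"] show ?thesis
    by (simp add: column_def axis_def matrix_vector_mult_def)
qed

lemma absorption_nonneg: "absorption $ i $ v \<ge> 0"
proof -
  have "(- column v absorption) $ i \<le> 0"
  proof (rule maximum_principle[of UNIV])
    show "(1 + \<alpha>) * (- column v absorption) $ i \<le> (P *v (- column v absorption)) $ i" for i
      using absorption_first_step[of i v] alpha_pos
      by (auto simp: column_def matrix_vector_mult_def sum_negf split: if_splits)
  qed auto
  then show ?thesis by (simp add: column_def)
qed

lemma absorption_pos:
  assumes "(v, i) \<in> (edges P)\<^sup>*"
  shows "absorption $ i $ v > 0"
  using assms
proof (induction rule: rtrancl_induct)
  case base
  have "(\<Sum>j\<in>UNIV. P $ v $ j * absorption $ j $ v) \<ge> 0"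
    by (intro sum_nonneg mult_nonneg_nonneg P_nonneg absorption_nonneg)
  then have "(1 + \<alpha>) * absorption $ v $ v > 0"
    using absorption_first_step[of v v] alpha_pos by simp
  then show ?case
    using alpha_pos by (simp add: zero_less_mult_iff)
next
  case (step j i)
  then have "P $ i $ j * absorption $ j $ v > 0"
    by (simp add: edges_def)
  then have "(\<Sum>j\<in>UNIV. P $ i $ j * absorption $ j $ v) > 0"
    by (intro sum_pos2[of _ j]) (auto intro: mult_nonneg_nonneg P_nonneg absorption_nonneg)
  then have "(1 + \<alpha>) * absorption $ i $ v > 0"
    using absorption_first_step[of i v] alpha_pos by (simp split: if_splits)
  then show ?case
    using alpha_pos by (simp add: zero_less_mult_iff)
qed

text \<open>The vertices not reachable from \<open>v\<close> form a set closed under the steps of the walk and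
  avoiding \<open>v\<close>. On it column \<open>v\<close> satisfies the hypothesis of the maximum principle, hence
  cannot be positive there.\<close>

lemma absorption_pos_iff: "absorption $ i $ v > 0 \<longleftrightarrow> (v, i) \<in> (edges P)\<^sup>*"
proof
  assume "absorption $ i $ v > 0"
  show "(v, i) \<in> (edges P)\<^sup>*"
  proof (rule ccontr)
    assume unreachable: "(v, i) \<notin> (edges P)\<^sup>*"
    let ?Z = "{k. (v, k) \<notin> (edges P)\<^sup>*}"
    have "column v absorption $ i \<le> 0"
    proof (rule maximum_principle[of ?Z])
      fix k j
      assume "k \<in> ?Z" "P $ k $ j \<noteq> 0"
      then have "k = j \<or> (j, k) \<in> edges P"
        using P_nonneg[of k j] by (auto simp: edges_def)
      with \<open>k \<in> ?Z\<close> show "j \<in> ?Z"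
        by (auto intro: rtrancl_into_rtrancl)
    next
      fix k
      assume "k \<in> ?Z"
      then have "k \<noteq> v" by auto
      then show "(1 + \<alpha>) * column v absorption $ k \<le> (P *v column v absorption) $ k"
        using absorption_first_step[of k v] by (simp add: column_def matrix_vector_mult_def)
    qed (use unreachable in simp)
    with \<open>absorption $ i $ v > 0\<close> show False by (simp add: column_def)
  qed
qed (rule absorption_pos)

section \<open>Reaches of the extended graph\<close>

abbreviation A :: "real ^ ('n + 'n) ^ ('n + 'n)" where
  "A \<equiv> ext_stoch \<alpha> P"

lemmas A_blocks = ext_stoch_blocks[OF alpha_pos P_row_sum]

abbreviation R :: "'n \<Rightarrow> ('n + 'n) set" where
  "R v \<equiv> reachable_set A (Inl v)"

lemma edges_A:
  "(x, Inl u) \<notin> edges A"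
  "(Inl v, Inr i) \<in> edges A \<longleftrightarrow> v = i"
  "(Inr j, Inr i) \<in> edges A \<longleftrightarrow> (j, i) \<in> edges P"
proof -
  have pos: "\<alpha> / (1 + \<alpha>) > 0" "1 / (1 + \<alpha>) > 0"
    using alpha_pos by auto
  show "(x, Inl u) \<notin> edges A"
    by (cases x) (auto simp: edges_def A_blocks mat_def)
  show "(Inl v, Inr i) \<in> edges A \<longleftrightarrow> v = i"
    using pos(1) by (auto simp: edges_def A_blocks(3) mat_def)
  show "(Inr j, Inr i) \<in> edges A \<longleftrightarrow> (j, i) \<in> edges P"
    using zero_less_mult_iff[of "1 / (1 + \<alpha>)"] pos(2) by (auto simp: edges_def A_blocks(4))
qed

lemma Inl_reachable_iff: "Inl u \<in> reachable_set A x \<longleftrightarrow> x = Inl u"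
  by (auto simp: reachable_set_def edges_A elim: rtranclE)

lemma Inr_reachable_iff: "Inr i \<in> R v \<longleftrightarrow> (v, i) \<in> (edges P)\<^sup>*"
proof
  have "(v, i) \<in> (edges P)\<^sup>*" if "(Inl v, y) \<in> (edges A)\<^sup>*" "y = Inr i" for y i
    using that
  proof (induction arbitrary: i rule: rtrancl_induct)
    case (step y z)
    then show ?case
      using Inl_reachable_iff[of _ "Inl v"]
      by (cases y) (auto simp: edges_A reachable_set_def intro: rtrancl_into_rtrancl)
  qed simp
  then show "(v, i) \<in> (edges P)\<^sup>*" if "Inr i \<in> R v"
    using that by (auto simp: reachable_set_def)
next
  assume "(v, i) \<in> (edges P)\<^sup>*"
  then show "Inr i \<in> R v"
    unfolding reachable_set_def
    by (induction rule: rtrancl_induct) (auto simp: edges_A intro: rtrancl_into_rtrancl)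
qed

lemma R_eq_iff: "reachable_set A x = R v \<longleftrightarrow> x = Inl v"
  using Inl_reachable_iff[of v x] Inl_reachable_iff[of v "Inl v"] by auto

text \<open>No edge enters \<open>b\<^sub>v\<close>, so a reachable set containing \<open>b\<^sub>v\<close> is that of \<open>b\<^sub>v\<close>, which makes it
  maximal. The reachable set of an old vertex \<open>i\<close> is not, as it is contained in the one of
  \<open>b\<^sub>i\<close>.\<close>

lemma reaches_A: "reaches A = range R"
proof (intro equalityI subsetI)
  fix S
  assume S: "S \<in> reaches A"
  then obtain x where x: "S = reachable_set A x"
    by (auto simp: reaches_def)
  show "S \<in> range R"
  proof (cases x)
    case (Inr i)
    have "(Inl i, Inr i) \<in> edges A" by (simp add: edges_A)
    then have "S \<subseteq> R i"
      unfolding x Inr reachable_set_def by (auto intro: converse_rtrancl_into_rtrancl)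
    then have "R i = S"
      using S by (auto simp: reaches_def)
    then show ?thesis by auto
  qed (use x in auto)
next
  fix S
  assume "S \<in> range R"
  then obtain v where v: "S = R v" by auto
  have "reachable_set A x = R v" if "R v \<subseteq> reachable_set A x" for x
    using that Inl_reachable_iff by (metis subsetD)
  then show "S \<in> reaches A"
    using v by (auto simp: reaches_def)
qed

lemma cabal_A: "cabal A (R v) = {Inl v}"
  by (auto simp: cabal_def R_eq_iff Inl_reachable_iff)

text \<open>The condition is phrased by \<open>x \<notin> R u\<close> rather than by concluding \<open>u = v\<close>: the latter would be
  a rewrite rule whose left-hand side is a bare variable.\<close>

lemma exclusive_part_A: "exclusive_part A (R v) = {x \<in> R v. \<forall>u. u \<noteq> v \<longrightarrow> x \<notin> R u}"
proof -
  have "R u \<in> range R - {R v} \<longleftrightarrow> u \<noteq> v" for u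
    by (simp add: R_eq_iff)
  then show ?thesis
    unfolding exclusive_part_def reaches_A by blast
qed

section \<open>The kernels of the extended graph\<close>

text \<open>The vector with values \<open>x\<close> on the \<open>b\<^sub>v\<close> and \<open>K x\<close> on the old vertices. For \<open>K = absorption\<close>
  this is the harmonic extension of \<open>x\<close>, which parametrises the right kernel; \<open>K = 0\<close>
  parametrises the left kernel. Both bases are thus handled at once.\<close>

definition lift :: "real ^ 'n ^ 'n \<Rightarrow> real ^ 'n \<Rightarrow> real ^ ('n + 'n)" where
  "lift K x = (\<chi> z. case z of Inl v \<Rightarrow> x $ v | Inr i \<Rightarrow> (K *v x) $ i)"

lemma lift_nth [simp]: "lift K x $ Inl v = x $ v" "lift K x $ Inr i = (K *v x) $ i"
  by (simp_all add: lift_def)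

lemma lift_eqI:
  assumes "\<And>v. y $ Inl v = x $ v" and "\<And>i. y $ Inr i = (K *v x) $ i"
  shows "y = lift K x"
  unfolding vec_eq_iff
proof
  show "y $ z = lift K x $ z" for z
    using assms by (cases z) auto
qed

lemma mult_axis_nth:
  fixes K :: "real ^ 'n ^ 'n"
  shows "(K *v axis v 1) $ i = K $ i $ v"
  by (simp add: matrix_vector_mult_basis column_def)

lemma linear_lift: "linear (lift K)"
  by (rule linearI; rule lift_eqI[symmetric])
     (simp_all add: matrix_vector_right_distrib matrix_vector_mult_scaleR)

lemma inj_lift: "inj (lift K)"
  by (rule injI) (metis lift_nth(1) vec_eq_iff)

text \<open>The reach is stored as a set of vertices; the source \<open>b\<^sub>v\<close> of a reach \<open>S\<close> is recovered as the
  only new vertex in \<open>S\<close>, so that the boundary vector below is the unit vector at \<open>v\<close>.\<close>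

definition reach_vector :: "real ^ 'n ^ 'n \<Rightarrow> ('n + 'n) set \<Rightarrow> real ^ ('n + 'n)" where
  "reach_vector K S = (if S \<in> reaches A then lift K (\<chi> v. if Inl v \<in> S then 1 else 0) else 0)"

lemma reach_vector_R: "reach_vector K (R v) = lift K (axis v 1)"
  by (simp add: reach_vector_def reaches_A Inl_reachable_iff axis_def eq_commute)

text \<open>These vectors are the image of the standard basis under the injective linear map
  \<open>lift K\<close>, hence a basis of its range.\<close>

lemma reach_vector_basis:
  shows "inj_on (reach_vector K) (reaches A)"
    and "independent (reach_vector K ` reaches A)"
    and "span (reach_vector K ` reaches A) = range (lift K)"
    and "(\<Sum>S\<in>reaches A. reach_vector K S) = lift K 1"
proof -
  have image: "reach_vector K ` reaches A = lift K ` Basis"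
    by (auto simp: reaches_A reach_vector_R Basis_vec_def image_iff)
  have injR: "inj R"
    by (rule injI) (simp add: R_eq_iff)
  show "inj_on (reach_vector K) (reaches A)"
    unfolding reaches_A
    by (rule inj_onI)
       (auto simp: reach_vector_R inj_eq[OF inj_lift] axis_eq_axis)
  show "independent (reach_vector K ` reaches A)"
    unfolding image
    by (intro linear_independent_injective_image linear_lift independent_Basis inj_on_subset[OF inj_lift]) auto
  show "span (reach_vector K ` reaches A) = range (lift K)"
    unfolding image linear_span_image[OF linear_lift] by simp
  have "(\<Sum>S\<in>reaches A. reach_vector K S) = (\<Sum>v\<in>UNIV. lift K (axis v 1))"
    unfolding reaches_A by (simp add: sum.reindex[OF injR] reach_vector_R)
  also have "\<dots> = lift K (\<Sum>v\<in>UNIV. axis v 1)"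
    by (simp add: linear_sum[OF linear_lift])
  also have "(\<Sum>v\<in>UNIV. axis v 1) = (1 :: real ^ 'n)"
    by (simp add: vec_eq_iff axis_def)
  finally show "(\<Sum>S\<in>reaches A. reach_vector K S) = lift K 1" .
qed

text \<open>The rows of \<open>A\<close> at the \<open>b\<^sub>v\<close> impose nothing, as \<open>b\<^sub>v\<close> is absorbing; the other rows are the
  equation of \<open>absorption_mult_eq_iff\<close>.\<close>

lemma right_kernel_A: "{x. (mat 1 - A) *v x = 0} = range (lift absorption)"
proof -
  have "(mat 1 - A) *v x = 0 \<longleftrightarrow> x = lift absorption (\<chi> v. x $ Inl v)" for x
  proof -
    let ?l = "\<chi> v. x $ Inl v" and ?r = "\<chi> i. x $ Inr i"
    have Inl: "(A *v x) $ Inl v = x $ Inl v" for v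
      by (simp add: matrix_vector_mult_def sum_UNIV_sum A_blocks mat_def sum_UNIV_if_eq)
    have Inr: "(A *v x) $ Inr i = (\<alpha> * x $ Inl i + (P *v ?r) $ i) / (1 + \<alpha>)" for i
      by (simp add: matrix_vector_mult_def sum_UNIV_sum A_blocks mat_def sum_UNIV_if_eq
          add_divide_distrib mult.assoc flip: sum_distrib_left sum_divide_distrib)
    have "(mat 1 - A) *v x = 0 \<longleftrightarrow> (\<forall>z. x $ z = (A *v x) $ z)"
      by (simp add: matrix_vector_mult_diff_rdistrib vec_eq_iff)
    also have "\<dots> \<longleftrightarrow> (\<forall>i. x $ Inr i = (A *v x) $ Inr i)"
      using Inl by (metis old.sum.exhaust)
    also have "\<dots> \<longleftrightarrow> (1 + \<alpha>) *\<^sub>R ?r = \<alpha> *\<^sub>R ?l + P *v ?r"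
      unfolding Inr using alpha_pos by (simp add: vec_eq_iff field_simps)
    also have "\<dots> \<longleftrightarrow> ?r = absorption *v ?l"
      by (simp only: absorption_mult_eq_iff)
    also have "\<dots> \<longleftrightarrow> x = lift absorption ?l"
    proof
      assume "?r = absorption *v ?l"
      then show "x = lift absorption ?l"
        by (intro lift_eqI) (simp_all add: vec_eq_iff)
    next
      assume "x = lift absorption ?l"
      then have "x $ Inr i = (absorption *v ?l) $ i" for i
        by (metis lift_nth(2))
      then show "?r = absorption *v ?l"
        by (simp add: vec_eq_iff)
    qed
    finally show ?thesis .
  qed
  then have eq: "{x. (mat 1 - A) *v x = 0} = {x. x = lift absorption (\<chi> v. x $ Inl v)}"
    by (simp only:)
  have "lift absorption y = lift absorption (\<chi> v. lift absorption y $ Inl v)" for y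
    by simp
  then show ?thesis
    unfolding eq by blast
qed

text \<open>The column of \<open>A\<close> at \<open>b\<^sub>v\<close> yields \<open>y(b\<^sub>v) = y(b\<^sub>v) + \<alpha> / (1 + \<alpha>) y(v)\<close>, so a stationary vector
  has no mass on the old vertices.\<close>

lemma left_kernel_A: "{y. y v* (mat 1 - A) = 0} = range (lift 0)"
proof -
  have Inl: "(y v* A) $ Inl v = y $ Inl v + \<alpha> / (1 + \<alpha>) * y $ Inr v" for y v
    by (simp add: vector_matrix_mult_def sum_UNIV_sum A_blocks mat_def if_distrib[of "\<lambda>x. _ * x"]
        cong: if_cong)
  have Inr: "(lift 0 x v* A) $ Inr i = 0" for x i
    by (simp add: vector_matrix_mult_def sum_UNIV_sum A_blocks)
  have eq: "y v* (mat 1 - A) = 0 \<longleftrightarrow> (\<forall>z. y $ z = (y v* A) $ z)" for y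
    by (simp add: vector_matrix_mult_def vec_eq_iff algebra_simps sum_subtractf
        mat_def sum_UNIV_if_eq)
  show ?thesis
  proof (intro equalityI subsetI)
    fix y
    assume "y \<in> {y. y v* (mat 1 - A) = 0}"
    then have "y $ Inr v = 0" for v
      using eq[of y] Inl[of y v] alpha_pos by (auto dest: spec[of _ "Inl v"])
    then have "y = lift 0 (\<chi> v. y $ Inl v)"
      by (intro lift_eqI) simp_all
    then show "y \<in> range (lift 0)" by blast
  next
    fix y
    assume "y \<in> range (lift 0)"
    then obtain x where y: "y = lift 0 x" by auto
    have "y $ z = (y v* A) $ z" for z
      by (cases z) (simp_all add: y Inl Inr)
    then show "y \<in> {y. y v* (mat 1 - A) = 0}"
      by (simp add: eq)
  qed
qed

lemma Inr_in_R_iff: "Inr i \<in> R v \<longleftrightarrow> absorption $ i $ v > 0"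
  by (simp add: absorption_pos_iff Inr_reachable_iff)

text \<open>A row of \<open>absorption\<close> is a probability distribution on the sources from which the vertex is
  reachable. So its entry at \<open>v\<close> is \<open>1\<close> when \<open>v\<close> is the only such source, and is strictly between
  \<open>0\<close> and \<open>1\<close> when \<open>v\<close> is one of several.\<close>

lemma absorption_exclusive:
  assumes "Inr i \<in> exclusive_part A (R v)"
  shows "absorption $ i $ v = 1"
proof -
  have "\<not> 0 < absorption $ i $ u" if "u \<noteq> v" for u
    using assms that unfolding exclusive_part_A Inr_in_R_iff[symmetric] by blast
  then have "absorption $ i $ u = 0" if "u \<noteq> v" for u
    using that absorption_nonneg[of i u] by (simp add: order.order_iff_strict)
  then have "(\<Sum>u\<in>UNIV. absorption $ i $ u) = (\<Sum>u\<in>UNIV. if u = v then absorption $ i $ v else 0)"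
    by (intro sum.cong) auto
  then show ?thesis by (simp add: absorption_row_sum)
qed

lemma absorption_common:
  assumes "Inr i \<in> common_part A (R v)"
  shows "0 < absorption $ i $ v" "absorption $ i $ v < 1"
proof -
  obtain u where "u \<noteq> v" and u: "0 < absorption $ i $ u" and v: "0 < absorption $ i $ v"
    using assms unfolding common_part_def exclusive_part_A Inr_in_R_iff[symmetric] by blast
  have "absorption $ i $ u + absorption $ i $ v = (\<Sum>k\<in>{u, v}. absorption $ i $ k)"
    using \<open>u \<noteq> v\<close> by simp
  also have "\<dots> \<le> (\<Sum>k\<in>UNIV. absorption $ i $ k)"
    by (intro sum_mono2) (auto simp: absorption_nonneg)
  finally show "absorption $ i $ v < 1"
    using u by (simp add: absorption_row_sum)
  show "0 < absorption $ i $ v" by fact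
qed

text \<open>Uniqueness: any admissible column lies in the right kernel, hence is the lift of its values on
  the new vertices. Those are prescribed, because \<open>b\<^sub>v\<close> is exclusive to the reach of \<open>b\<^sub>v\<close> and the
  other new vertices lie outside it.\<close>

lemma Gamma0_A: "Gamma0 A = (\<chi> z S. reach_vector absorption S $ z)"
  unfolding Gamma0_def
proof (rule the_equality)
  let ?\<Gamma> = "\<chi> z S. reach_vector absorption S $ z"
  have col: "column S ?\<Gamma> = reach_vector absorption S" for S
    by (simp add: column_def vec_eq_iff)
  have entries: "(\<forall>x\<in>exclusive_part A S. reach_vector absorption S $ x = 1) \<and>
    (\<forall>x\<in>common_part A S. 0 < reach_vector absorption S $ x \<and> reach_vector absorption S $ x < 1) \<and>
    (\<forall>x. x \<notin> S \<longrightarrow> reach_vector absorption S $ x = 0)" if reach: "S \<in> reaches A" for S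
  proof -
    obtain v where S: "S = R v"
      using reach by (auto simp: reaches_A)
    have Inl: "reach_vector absorption (R v) $ Inl u = (if u = v then 1 else 0)" for u
      by (simp add: S reach_vector_R axis_def)
    have Inr: "reach_vector absorption (R v) $ Inr i = absorption $ i $ v" for i
      by (simp add: S reach_vector_R mult_axis_nth)
    have "reach_vector absorption S $ x = 1" if "x \<in> exclusive_part A S" for x
    proof (cases x)
      case x: (Inl u)
      show ?thesis
        using that unfolding x S
        by (auto simp: reach_vector_R exclusive_part_A Inl_reachable_iff axis_def)
    next
      case x: (Inr i)
      show ?thesis
        using that unfolding x S
        using absorption_exclusive[of i v] by (simp add: Inr)
    qed
    moreover have "0 < reach_vector absorption S $ x \<and> reach_vector absorption S $ x < 1"
      if "x \<in> common_part A S" for x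
    proof (cases x)
      case x: (Inl u)
      show ?thesis
        using that unfolding x S by (auto simp: common_part_def exclusive_part_A Inl_reachable_iff)
    next
      case x: (Inr i)
      show ?thesis
        using that unfolding x S
        using absorption_common[of i v] by (simp add: Inr)
    qed
    moreover have "reach_vector absorption S $ x = 0" if "x \<notin> S" for x
    proof (cases x)
      case x: (Inl u)
      show ?thesis
        using that unfolding x S by (auto simp: Inl Inl_reachable_iff)
    next
      case x: (Inr i)
      show ?thesis
        using that unfolding x S
        using absorption_nonneg[of i v] by (simp add: Inr Inr_in_R_iff)
    qed
    ultimately show ?thesis by blast
  qed
  have zero: "reach_vector absorption S = 0" if "S \<notin> reaches A" for S
    using that by (simp add: reach_vector_def)
  have "lift absorption 1 = 1"
    by (rule lift_eqI[symmetric]) (simp_all add: absorption_mult_one)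
  then show "is_right_kernel_basis A ?\<Gamma>"
    unfolding is_right_kernel_basis_def col right_kernel_A
    using reach_vector_basis[of absorption] entries zero by simp
next
  fix \<Gamma>
  assume \<Gamma>: "is_right_kernel_basis A \<Gamma>"
  have "column S \<Gamma> = reach_vector absorption S" for S
  proof (cases "S \<in> reaches A")
    case True
    then obtain v where v: "S = R v" by (auto simp: reaches_A)
    have "column S \<Gamma> \<in> range (lift absorption)"
      using \<Gamma> True unfolding is_right_kernel_basis_def right_kernel_A
      by (metis imageI span_base)
    then obtain x where x: "column S \<Gamma> = lift absorption x" by auto
    have "x $ u = axis v 1 $ u" for u
    proof -
      have "x $ u = \<Gamma> $ Inl u $ S"
        using arg_cong[OF x, of "\<lambda>y. y $ Inl u"] by (simp add: column_def)
      moreover have "Inl v \<in> exclusive_part A S"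
        by (simp add: v exclusive_part_A Inl_reachable_iff)
      moreover have "Inl u \<notin> S" if "u \<noteq> v"
        using that by (simp add: v Inl_reachable_iff)
      ultimately show ?thesis
        using \<Gamma> True unfolding is_right_kernel_basis_def by (auto simp: axis_def)
    qed
    then have "x = axis v 1" by (simp add: vec_eq_iff)
    then show ?thesis
      using x unfolding v reach_vector_R by simp
  next
    case False
    then show ?thesis
      using \<Gamma> by (simp add: is_right_kernel_basis_def reach_vector_def)
  qed
  then show "\<Gamma> = (\<chi> z S. reach_vector absorption S $ z)"
    by (simp add: vec_eq_iff column_def)
qed

text \<open>Uniqueness: a row with support \<open>{b\<^sub>v}\<close> and entries summing to \<open>1\<close> is a unit vector.\<close>

lemma Gamma0_bar_A: "Gamma0_bar A = (\<chi> S. reach_vector 0 S)"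
  unfolding Gamma0_bar_def
proof (rule the_equality)
  let ?\<Gamma> = "\<chi> S. reach_vector 0 S"
  have row: "row S ?\<Gamma> = reach_vector 0 S" for S
    by (simp add: row_def vec_eq_iff)
  have nth: "reach_vector 0 (R v) $ x = (if x = Inl v then 1 else 0)" for v x
    by (cases x) (simp_all add: reach_vector_R axis_def)
  have entries: "(\<forall>x. reach_vector 0 S $ x \<ge> 0) \<and>
    {x. reach_vector 0 S $ x \<noteq> 0} = cabal A S \<and>
    (\<Sum>x\<in>UNIV. reach_vector 0 S $ x) = 1" if reach: "S \<in> reaches A" for S
  proof -
    obtain v where S: "S = R v"
      using reach by (auto simp: reaches_A)
    show ?thesis
      by (simp add: S nth cabal_A)
  qed
  have zero: "reach_vector 0 S = 0" if "S \<notin> reaches A" for S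
    using that by (simp add: reach_vector_def)
  show "is_left_kernel_basis A ?\<Gamma>"
    unfolding is_left_kernel_basis_def row left_kernel_A
    using reach_vector_basis[of 0] entries zero by simp
next
  fix \<Gamma>
  assume \<Gamma>: "is_left_kernel_basis A \<Gamma>"
  have "row S \<Gamma> = reach_vector 0 S" for S
  proof (cases "S \<in> reaches A")
    case True
    then obtain v where v: "S = R v" by (auto simp: reaches_A)
    have "{x. \<Gamma> $ S $ x \<noteq> 0} = {Inl v}" and total: "(\<Sum>x\<in>UNIV. \<Gamma> $ S $ x) = 1"
      using \<Gamma> True unfolding is_left_kernel_basis_def by (auto simp: v cabal_A)
    then have zero: "\<Gamma> $ S $ x = 0" if "x \<noteq> Inl v" for x
      using that by auto
    have "\<Gamma> $ S $ Inl v = 1"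
      using total sum.remove[of UNIV "Inl v" "\<lambda>x. \<Gamma> $ S $ x"] by (simp add: zero)
    with zero show ?thesis
      unfolding v reach_vector_R
      by (intro lift_eqI) (auto simp: row_def axis_def)
  next
    case False
    then show ?thesis
      using \<Gamma> by (simp add: is_left_kernel_basis_def reach_vector_def)
  qed
  then show "\<Gamma> = (\<chi> S. reach_vector 0 S)"
    by (simp add: vec_eq_iff row_def)
qed

section \<open>Influence and pagerank\<close>

text \<open>Only the reach of \<open>b\<^sub>v\<close> has a left basis vector that is nonzero at \<open>b\<^sub>v\<close>, so column \<open>b\<^sub>v\<close> of
  the product of the two basis matrices is \<open>\<gamma>\<^sub>v\<close>. The summand \<open>1\<close> is the entry of \<open>\<gamma>\<^sub>v\<close> at \<open>b\<^sub>v\<close>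
  itself.\<close>

lemma influence_Inl:
  "influence A (Inl v) = (1 + (\<Sum>i\<in>UNIV. absorption $ i $ v)) / (2 * real CARD('n))"
proof -
  have bar: "Gamma0_bar A $ S $ Inl v = (if S = R v then 1 else 0)" for S
    by (auto simp: Gamma0_bar_A reach_vector_def reaches_A Inl_reachable_iff)
  have "(Gamma0 A ** Gamma0_bar A) $ x $ Inl v = lift absorption (axis v 1) $ x" for x
    unfolding matrix_matrix_mult_def
    by (simp add: bar sum_UNIV_if_eq) (simp add: Gamma0_A reach_vector_R)
  then have "(1 v* (Gamma0 A ** Gamma0_bar A)) $ Inl v = 1 + (\<Sum>i\<in>UNIV. absorption $ i $ v)"
    by (simp add: vector_matrix_mult_def sum_UNIV_sum mult_axis_nth) (simp add: axis_def)
  then show ?thesis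
    by (simp add: influence_def inner_axis)
qed

lemma pagerank_nth: "pagerank \<alpha> P $ v = (\<Sum>i\<in>UNIV. absorption $ i $ v) / real CARD('n)"
  by (simp add: pagerank_def influence_Inl field_simps)

lemma pagerank_eq: "pagerank \<alpha> P = (\<alpha> / real CARD('n)) *\<^sub>R (1 v* matrix_inv D)"
  by (simp add: vec_eq_iff pagerank_nth absorption_def vector_matrix_mult_def flip: sum_distrib_left)

lemma prob_vector_pagerank: "prob_vector (pagerank \<alpha> P)"
proof -
  have "(\<Sum>v\<in>UNIV. pagerank \<alpha> P $ v) = (\<Sum>v\<in>UNIV. \<Sum>i\<in>UNIV. absorption $ i $ v) / real CARD('n)"
    by (simp add: pagerank_nth sum_divide_distrib)
  also have "\<dots> = (\<Sum>i\<in>UNIV. \<Sum>v\<in>UNIV. absorption $ i $ v) / real CARD('n)"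
    by (subst sum.swap) simp
  also have "\<dots> = 1"
    by (simp add: absorption_row_sum)
  finally show ?thesis
    by (simp add: prob_vector_def pagerank_nth absorption_nonneg sum_nonneg)
qed

end

theorem theorem6p1:
  fixes E :: "('n::finite \<times> 'n) set" and w :: "'n \<times> 'n \<Rightarrow> real"
    and P L :: "real ^ 'n ^ 'n" and \<alpha> :: real
  assumes "weighted_digraph E w"
    and "weakly_connected E"
    and "P = stoch (adjacency E w) \<or> P = stoch_teleport (adjacency E w)"
    and "L = mat 1 - P"
    and "\<alpha> > 0"
  shows "invertible (\<alpha> *\<^sub>R mat 1 + L)
    \<and> prob_vector (pagerank \<alpha> P)
    \<and> pagerank \<alpha> P = (\<alpha> / real CARD('n)) *\<^sub>R (1 v* matrix_inv (\<alpha> *\<^sub>R mat 1 + L))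
    \<and> (\<forall>x. prob_vector x \<and> x = (\<alpha> / real CARD('n)) *\<^sub>R (1 v* matrix_inv (\<alpha> *\<^sub>R mat 1 + L))
           \<longrightarrow> x = pagerank \<alpha> P)"
proof -
  have "row_stochastic P"
    using assms(3) adjacency_nonneg[OF assms(1)]
      row_stochastic_stoch[of "adjacency E w"] row_stochastic_stoch_teleport[of "adjacency E w"]
    by auto
  then interpret extended_graph P \<alpha>
    using assms(5) by unfold_locales
  show ?thesis
    unfolding assms(4) using D_invertible prob_vector_pagerank pagerank_eq by simp
qed

end
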